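(* Let $\omega\in\mathcal{W}^\infty$ be (the class of) an infinite reduced word on $S$. Then $\operatorname{conv}(\widehat N(\omega))\cap\operatorname{conv}(E)=\varnothing$.
   Context: Setting. $V$ is a finite-dimensional real vector space with a symmetric bilinear form $B$. For $\alpha\in V$ with $B(\alpha,\alpha)\neq 0$, let $s_\alpha(v)=v-2\frac{B(\alpha,v)}{B(\alpha,\alpha)}\alpha$. For $A\subseteq V$, $\operatorname{cone}(A)$ is the set of finite non-negative linear combinations of elements of $A$, and $\operatorname{conv}$ denotes convex hull. $(W,S)$ is a Coxeter system with $S$ finite, given with a geometric representation: $W\subseteq O_B(V)$ and each $s\in S$ equals $s_{\alpha_s}$, where $\Delta=\{\alpha_s\mid s\in S\}$ is a simple system, i.e. (1) $\Delta$ is positively linearly independent: if $\sum_{\alpha\in\Delta}a_\alpha\alpha=0$ with all $a_\alpha\ge 0$, then all $a_\alpha=0$; (2) for distinct $\alpha,\beta\in\Delta$, $B(\alpha,\beta)\in\,]-\infty,-1]\cup\{-\cos(\pi/k)\mid k\in\mathbb{Z}_{\ge 2}\}$; (3) $B(\alpha,\alpha)=1$ for all $\alpha\in\Delta$. ($B(\alpha_s,\alpha_t)=-\cos(\pi/m)$ if $st$ has finite order $m$, and $B(\alpha_s,\alpha_t)\le -1$ if $st$ has infinite order.) The root system is $\Phi=W(\Delta)$, the positive roots are $\Phi^+=\operatorname{cone}(\Delta)\cap\Phi$, and $\Phi^-=-\Phi^+$; one has $\Phi=\Phi^+\sqcup\Phi^-$. For $w\in W$, $N(w)=\Phi^+\cap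 w(\Phi^-)$. Infinite reduced words. With $\ell$ the length function, the (right) weak order is $u\le w$ iff $\ell(w)=\ell(u)+\ell(u^{-1}w)$. An infinite word $\omega=s_1s_2s_3\cdots$ on $S$ is an infinite reduced word if for every $i\ge1$ the word $w_i=s_1\cdots s_i$ is reduced; $w_i$ also denotes the corresponding element of $W$. $\mathcal{W}$ is the set of infinite reduced words. For $\omega,\omega'\in\mathcal{W}$ with prefixes $w_i,w'_j$, write $\omega\prec\omega'$ if for every $i$ there is $j$ with $w_i\le w'_j$, and $\omega\sim\omega'$ if $\omega\prec\omega'$ and $\omega'\prec\omega$. $\mathcal{W}^\infty=\mathcal{W}/\!\sim$. The inversion set of $\omega$ is $N(\omega)=\bigcup_{i\ge1}N(w_i)\subseteq\Phi^+$; it depends only on the class of $\omega$ in $\mathcal{W}^\infty$. Normalized roots and limit roots. Fix an affine hyperplane $V_1$ of $V$ transverse to $\Phi^+$: for every $\beta\in\Phi^+$ the ray $\mathbb{R}^+\beta$ meets $V_1$ in a unique nonzero point $\widehat\beta$; put $\widehat{-\beta}=\widehat\beta$. For $A\subseteq\Phi$, $\widehat A=\{\widehat\beta\mid\beta\in A\}$, and $\widehat N(\omega)=\widehat{N(\omega)}$. $E\subseteq V_1$ is the set of accumulation points of $\widehat\Phi$ (the set of limit roots). *)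

theory Defs
  imports "HOL-Analysis.Analysis" "HOL-Algebra.Multiplicative_Group"
begin

section \<open>Coxeter systems and words\<close>

definition word_prod :: "('g, 'm) monoid_scheme \<Rightarrow> 'g list \<Rightarrow> 'g" where
  "word_prod G xs = foldr (mult G) xs (one G)"

text \<open>
  One application of a Coxeter relation \<open>(s t)\<^sup>m = 1\<close>, where \<open>m\<close> is the order of \<open>s t\<close>.
  Since \<open>group.ord\<close> is \<open>0\<close> on elements of infinite order, the step does nothing for such a pair,
  and for \<open>s = t\<close> (where \<open>m = 1\<close>) it is the relation \<open>s s = 1\<close>.
\<close>
inductive coxeter_step :: "('g, 'm) monoid_scheme \<Rightarrow> 'g set \<Rightarrow> 'g list \<Rightarrow> 'g list \<Rightarrow> bool"
  for G :: "('g, 'm) monoid_scheme" and S :: "'g set" where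
  "\<lbrakk>s \<in> S; t \<in> S; set xs \<subseteq> S; set ys \<subseteq> S\<rbrakk> \<Longrightarrow>
    coxeter_step G S (xs @ concat (replicate (group.ord G (s \<otimes>\<^bsub>G\<^esub> t)) [s, t]) @ ys) (xs @ ys)"

text \<open>
  The last condition says that the Coxeter relations present \<open>G\<close>. All relations \<open>s s = 1\<close> are among
  them, so presenting \<open>G\<close> as a monoid is the same as presenting it as a group, and no formal
  inverses of the letters are needed.
\<close>
definition coxeter_system :: "('g, 'm) monoid_scheme \<Rightarrow> 'g set \<Rightarrow> bool" where
  "coxeter_system G S \<longleftrightarrow>
     group G \<and> S \<subseteq> carrier G \<and> generate G S = carrier G \<and>
     (\<forall>s\<in>S. group.ord G s = 2) \<and>
     (\<forall>xs ys. set xs \<subseteq> S \<and> set ys \<subseteq> S \<and> word_prod G xs = word_prod G ys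
        \<longrightarrow> equivclp (coxeter_step G S) xs ys)"

definition word_length :: "('g, 'm) monoid_scheme \<Rightarrow> 'g set \<Rightarrow> 'g \<Rightarrow> nat" where
  "word_length G S w = (LEAST n. \<exists>xs. set xs \<subseteq> S \<and> length xs = n \<and> word_prod G xs = w)"

definition weak_le :: "('g, 'm) monoid_scheme \<Rightarrow> 'g set \<Rightarrow> 'g \<Rightarrow> 'g \<Rightarrow> bool" where
  "weak_le G S u w \<longleftrightarrow>
     word_length G S w = word_length G S u + word_length G S (inv\<^bsub>G\<^esub> u \<otimes>\<^bsub>G\<^esub> w)"

text \<open>
  The infinite word \<open>s\<^sub>1 s\<^sub>2 s\<^sub>3 \<dots>\<close> is the sequence \<open>\<omega>\<close> with \<open>\<omega> i\<close> the letter of index \<open>i + 1\<close>, so that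
  \<open>word_prefix G \<omega> i\<close> is the product of the first \<open>i\<close> letters.
\<close>
definition word_prefix :: "('g, 'm) monoid_scheme \<Rightarrow> (nat \<Rightarrow> 'g) \<Rightarrow> nat \<Rightarrow> 'g" where
  "word_prefix G \<omega> i = word_prod G (map \<omega> [0..<i])"

definition inf_reduced_words :: "('g, 'm) monoid_scheme \<Rightarrow> 'g set \<Rightarrow> (nat \<Rightarrow> 'g) set" where
  "inf_reduced_words G S =
     {\<omega>. range \<omega> \<subseteq> S \<and> (\<forall>i\<ge>1. word_length G S (word_prefix G \<omega> i) = i)}"

definition word_prec :: "('g, 'm) monoid_scheme \<Rightarrow> 'g set \<Rightarrow> (nat \<Rightarrow> 'g) \<Rightarrow> (nat \<Rightarrow> 'g) \<Rightarrow> bool" where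
  "word_prec G S \<omega> \<omega>' \<longleftrightarrow>
     (\<forall>i\<ge>1. \<exists>j\<ge>1. weak_le G S (word_prefix G \<omega> i) (word_prefix G \<omega>' j))"

definition word_equiv :: "('g, 'm) monoid_scheme \<Rightarrow> 'g set \<Rightarrow> ((nat \<Rightarrow> 'g) \<times> (nat \<Rightarrow> 'g)) set" where
  "word_equiv G S =
     {(\<omega>, \<omega>'). \<omega> \<in> inf_reduced_words G S \<and> \<omega>' \<in> inf_reduced_words G S \<and>
        word_prec G S \<omega> \<omega>' \<and> word_prec G S \<omega>' \<omega>}"

definition inf_word_classes :: "('g, 'm) monoid_scheme \<Rightarrow> 'g set \<Rightarrow> (nat \<Rightarrow> 'g) set set" where
  "inf_word_classes G S = inf_reduced_words G S // word_equiv G S"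


section \<open>Geometric representations\<close>

definition orthogonal_group :: "('v::real_vector \<Rightarrow> 'v \<Rightarrow> real) \<Rightarrow> ('v \<Rightarrow> 'v) monoid" where
  "orthogonal_group B =
     \<lparr>carrier = {f. linear f \<and> bij f \<and> (\<forall>u v. B (f u) (f v) = B u v)}, mult = (\<circ>), one = id\<rparr>"

abbreviation orthogonal_subgroup ::
    "('v::real_vector \<Rightarrow> 'v \<Rightarrow> real) \<Rightarrow> ('v \<Rightarrow> 'v) set \<Rightarrow> ('v \<Rightarrow> 'v) monoid" where
  "orthogonal_subgroup B W \<equiv> (orthogonal_group B)\<lparr>carrier := W\<rparr>"

definition bilin_reflection :: "('v::real_vector \<Rightarrow> 'v \<Rightarrow> real) \<Rightarrow> 'v \<Rightarrow> 'v \<Rightarrow> 'v" where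
  "bilin_reflection B a v = v - (2 * (B a v / B a a)) *\<^sub>R a"

definition nonneg_cone :: "'v::real_vector set \<Rightarrow> 'v set" where
  "nonneg_cone A = {\<Sum>a\<in>F. c a *\<^sub>R a |F c. finite F \<and> F \<subseteq> A \<and> (\<forall>a\<in>F. 0 \<le> c a)}"

definition pos_lin_indep :: "'v::real_vector set \<Rightarrow> bool" where
  "pos_lin_indep D \<longleftrightarrow>
     (\<forall>c. (\<forall>a\<in>D. 0 \<le> c a) \<and> (\<Sum>a\<in>D. c a *\<^sub>R a) = 0 \<longrightarrow> (\<forall>a\<in>D. c a = (0::real)))"

definition simple_system :: "('v::real_vector \<Rightarrow> 'v \<Rightarrow> real) \<Rightarrow> 'v set \<Rightarrow> bool" where
  "simple_system B D \<longleftrightarrow>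
     finite D \<and> pos_lin_indep D \<and>
     (\<forall>a\<in>D. \<forall>b\<in>D. a \<noteq> b \<longrightarrow> B a b \<le> -1 \<or> (\<exists>k::nat. 2 \<le> k \<and> B a b = - cos (pi / real k))) \<and>
     (\<forall>a\<in>D. B a a = 1)"

text \<open>
  The type \<open>'v\<close> is an arbitrary finite-dimensional real vector space with its usual topology; its
  inner product is unrelated to \<open>B\<close> and plays no role. The map \<open>\<alpha>\<close> sends \<open>s\<close> to its simple root.
\<close>
locale geometric_representation =
  fixes B :: "'v::euclidean_space \<Rightarrow> 'v \<Rightarrow> real"
    and W S :: "('v \<Rightarrow> 'v) set"
    and \<alpha> :: "('v \<Rightarrow> 'v) \<Rightarrow> 'v"
  assumes bilinear_B: "bilinear B"
    and symmetric_B: "B u v = B v u"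
    and W_subgroup: "subgroup W (orthogonal_group B)"
    and finite_S: "finite S"
    and coxeter: "coxeter_system (orthogonal_subgroup B W) S"
    and S_reflections: "s \<in> S \<Longrightarrow> s = bilin_reflection B (\<alpha> s)"
    and simple: "simple_system B (\<alpha> ` S)"
    and B_finite_order:
      "\<lbrakk>s \<in> S; t \<in> S; s \<noteq> t; m = group.ord (orthogonal_subgroup B W) (s \<circ> t); m \<noteq> 0\<rbrakk>
        \<Longrightarrow> B (\<alpha> s) (\<alpha> t) = - cos (pi / real m)"
    and B_infinite_order:
      "\<lbrakk>s \<in> S; t \<in> S; s \<noteq> t; group.ord (orthogonal_subgroup B W) (s \<circ> t) = 0\<rbrakk>
        \<Longrightarrow> B (\<alpha> s) (\<alpha> t) \<le> -1"

definition root_system :: "('v \<Rightarrow> 'v) set \<Rightarrow> 'v set \<Rightarrow> 'v set" where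
  "root_system W D = {w a |w a. w \<in> W \<and> a \<in> D}"

definition pos_roots :: "('v::real_vector \<Rightarrow> 'v) set \<Rightarrow> 'v set \<Rightarrow> 'v set" where
  "pos_roots W D = nonneg_cone D \<inter> root_system W D"

definition neg_roots :: "('v::real_vector \<Rightarrow> 'v) set \<Rightarrow> 'v set \<Rightarrow> 'v set" where
  "neg_roots W D = uminus ` pos_roots W D"

definition inversions :: "('v::real_vector \<Rightarrow> 'v) set \<Rightarrow> 'v set \<Rightarrow> ('v \<Rightarrow> 'v) \<Rightarrow> 'v set" where
  "inversions W D w = pos_roots W D \<inter> w ` neg_roots W D"

definition inf_inversions ::
    "('v::real_vector \<Rightarrow> 'v \<Rightarrow> real) \<Rightarrow> ('v \<Rightarrow> 'v) set \<Rightarrow> 'v set \<Rightarrow> (nat \<Rightarrow> 'v \<Rightarrow> 'v) \<Rightarrow> 'v set" where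
  "inf_inversions B W D \<omega> =
     (\<Union>i\<in>{1..}. inversions W D (word_prefix (orthogonal_subgroup B W) \<omega> i))"


section \<open>Normalized roots and limit roots\<close>

definition affine_hyperplane :: "'v::euclidean_space set \<Rightarrow> bool" where
  "affine_hyperplane H \<longleftrightarrow> affine H \<and> aff_dim H = int DIM('v) - 1"

definition ray :: "'v::real_vector \<Rightarrow> 'v set" where
  "ray b = {t *\<^sub>R b |t. 0 \<le> t}"

definition transverse :: "'v::real_vector set \<Rightarrow> 'v set \<Rightarrow> bool" where
  "transverse H P \<longleftrightarrow> (\<forall>b\<in>P. \<exists>!x. x \<in> ray b \<inter> H \<and> x \<noteq> 0)"

text \<open>Here \<open>P\<close> is the set of positive roots; on other roots \<open>b\<close>, the value is that at \<open>- b\<close>.\<close>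
definition normalized_root :: "'v::real_vector set \<Rightarrow> 'v set \<Rightarrow> 'v \<Rightarrow> 'v" where
  "normalized_root H P b = (THE x. x \<in> ray (if b \<in> P then b else - b) \<inter> H \<and> x \<noteq> 0)"

definition limit_roots :: "('v::euclidean_space \<Rightarrow> 'v) set \<Rightarrow> 'v set \<Rightarrow> 'v set \<Rightarrow> 'v set" where
  "limit_roots W D H =
     {x. x islimpt (normalized_root H (pos_roots W D) ` root_system W D)}"

end

theory Submission
  imports Defs
begin

text \<open>
  Inversion sets increase along a reduced word (\<open>inversions_mono\<close>), so a convex combination of
  normalized inversions of \<open>\<omega>\<close>, which involves finitely many of them, is one of normalized
  inversions of a single prefix. So it suffices to separate, for one element \<open>w\<close> of \<open>W\<close>, the
  normalized inversions of \<open>w\<close> from the limit roots (\<open>hull_inversions_disjoint_hull_limit_roots\<close>).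

  The inverse of \<open>w\<close> does this: it sends the inversions of \<open>w\<close> to negative roots, and all other
  positive roots to positive roots. Only finitely many positive roots are inversions
  (\<open>finite_inversions\<close>), so they do not contribute to accumulation points, and the limit roots are
  sent into the cone over the simple roots, which is closed. Hence a point in both convex hulls is
  sent into the cone and into its negative. The cone is pointed, by positive independence of the
  simple roots, so the point is \<open>0\<close>; but a convex combination of nonzero elements of a pointed cone
  is not \<open>0\<close>.

  The facts about roots that this uses rest on \<open>root_in_cone\<close>: if right multiplication by a simple
  reflection \<open>s\<close> does not shorten \<open>w\<close>, then \<open>w\<close> sends the simple root of \<open>s\<close> into the cone. It
  is proved by induction on the length of \<open>w\<close>, splitting off from \<open>w\<close> a longest alternating end
  \<open>\<dots> s t s t\<close>; the alternating part acts in the span of two simple roots, with coefficients given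
  by Chebyshev polynomials.
\<close>

section \<open>Cones over finite sets\<close>

lemma nonneg_cone_finite:
  assumes "finite D"
  shows "nonneg_cone D = {\<Sum>a\<in>D. c a *\<^sub>R a |c. \<forall>a\<in>D. 0 \<le> c a}"
proof (intro subset_antisym subsetI)
  fix x assume "x \<in> nonneg_cone D"
  then obtain F c where F: "F \<subseteq> D" "\<forall>a\<in>F. 0 \<le> c a" and x: "x = (\<Sum>a\<in>F. c a *\<^sub>R a)"
    unfolding nonneg_cone_def by blast
  define d where "d a = (if a \<in> F then c a else 0)" for a
  have "(\<Sum>a\<in>D. d a *\<^sub>R a) = (\<Sum>a\<in>F. d a *\<^sub>R a)"
    by (rule sum.mono_neutral_right) (use assms F in \<open>auto simp: d_def\<close>)
  also have "\<dots> = x" unfolding x by (rule sum.cong) (auto simp: d_def)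
  finally show "x \<in> {\<Sum>a\<in>D. c a *\<^sub>R a |c. \<forall>a\<in>D. 0 \<le> c a}"
    using F by (auto simp: d_def intro!: exI[of _ d])
next
  fix x assume "x \<in> {\<Sum>a\<in>D. c a *\<^sub>R a |c. \<forall>a\<in>D. 0 \<le> c a}"
  then show "x \<in> nonneg_cone D"
    unfolding nonneg_cone_def using assms by blast
qed

lemma convex_cone_nonneg_cone:
  assumes "finite D"
  shows "convex_cone (nonneg_cone D)"
  unfolding convex_cone_iff
proof (intro conjI ballI allI impI)
  show "0 \<in> nonneg_cone D"
    by (auto simp: nonneg_cone_finite[OF assms] intro!: exI[of _ "\<lambda>_. 0"])
next
  fix x y assume "x \<in> nonneg_cone D" "y \<in> nonneg_cone D"
  then obtain c d where "\<forall>a\<in>D. 0 \<le> c a" "x = (\<Sum>a\<in>D. c a *\<^sub>R a)"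
      "\<forall>a\<in>D. 0 \<le> d a" "y = (\<Sum>a\<in>D. d a *\<^sub>R a)"
    unfolding nonneg_cone_finite[OF assms] by auto
  then show "x + y \<in> nonneg_cone D"
    unfolding nonneg_cone_finite[OF assms]
    by (auto simp: sum.distrib scaleR_left_distrib intro!: exI[of _ "\<lambda>a. c a + d a"])
next
  fix x and r :: real assume "x \<in> nonneg_cone D" "0 \<le> r"
  then obtain c where "\<forall>a\<in>D. 0 \<le> c a" "x = (\<Sum>a\<in>D. c a *\<^sub>R a)"
    unfolding nonneg_cone_finite[OF assms] by auto
  with \<open>0 \<le> r\<close> show "r *\<^sub>R x \<in> nonneg_cone D"
    unfolding nonneg_cone_finite[OF assms]
    by (auto simp: scaleR_sum_right intro!: exI[of _ "\<lambda>a. r * c a"])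
qed

lemma nonneg_cone_superset: "a \<in> D \<Longrightarrow> a \<in> nonneg_cone D"
  unfolding nonneg_cone_def by (auto intro!: exI[of _ "{a}"] exI[of _ "\<lambda>_. 1"])

text \<open>This makes available that the convex cone over a finite set is a polyhedron, hence
  closed.\<close>

lemma nonneg_cone_eq_hull:
  assumes "finite D"
  shows "nonneg_cone D = convex_cone hull D"
proof
  show "convex_cone hull D \<subseteq> nonneg_cone D"
    by (rule hull_minimal) (auto simp: convex_cone_nonneg_cone[OF assms] nonneg_cone_superset)
  show "nonneg_cone D \<subseteq> convex_cone hull D"
  proof
    fix x assume "x \<in> nonneg_cone D"
    then obtain F c where F: "finite F" "F \<subseteq> D" "\<forall>a\<in>F. 0 \<le> c a" and x: "x = (\<Sum>a\<in>F. c a *\<^sub>R a)"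
      unfolding nonneg_cone_def by blast
    show "x \<in> convex_cone hull D"
      unfolding x using F
      by (induction F rule: finite_induct)
        (simp_all add: convex_cone_hull_contains_0 convex_cone_hull_add convex_cone_hull_mul hull_inc)
  qed
qed

lemma closed_nonneg_cone:
  fixes D :: "'a::euclidean_space set"
  shows "finite D \<Longrightarrow> closed (nonneg_cone D)"
  by (simp add: nonneg_cone_eq_hull closed_convex_cone_hull)

lemma nonneg_cone_pointed:
  assumes "finite D" "pos_lin_indep D" "x \<in> nonneg_cone D" "- x \<in> nonneg_cone D"
  shows "x = 0"
proof -
  obtain c d where c: "\<forall>a\<in>D. 0 \<le> c a" "x = (\<Sum>a\<in>D. c a *\<^sub>R a)"
    and d: "\<forall>a\<in>D. 0 \<le> d a" "- x = (\<Sum>a\<in>D. d a *\<^sub>R a)"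
    using assms(3,4) unfolding nonneg_cone_finite[OF assms(1)] by auto
  have "(\<Sum>a\<in>D. (c a + d a) *\<^sub>R a) = x + - x"
    unfolding d(2) by (simp add: scaleR_left_distrib sum.distrib c(2))
  then have "(\<Sum>a\<in>D. (c a + d a) *\<^sub>R a) = 0" by simp
  moreover have "\<forall>a\<in>D. 0 \<le> c a + d a" using c(1) d(1) by simp
  ultimately have "\<forall>a\<in>D. c a + d a = 0"
    using spec[OF assms(2)[unfolded pos_lin_indep_def], of "\<lambda>a. c a + d a"]
    by (elim mp) (intro conjI)
  then have "\<forall>a\<in>D. c a = 0" using c(1) d(1) by (meson add_nonneg_eq_0_iff)
  then show ?thesis using c(2) by simp
qed

lemma convex_pointed_cone_minus_0:
  assumes "convex_cone C" and pointed: "\<And>x. x \<in> C \<Longrightarrow> - x \<in> C \<Longrightarrow> x = 0"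
  shows "convex (C - {0})"
proof (rule convexI)
  fix x y and u v :: real
  assume xy: "x \<in> C - {0}" "y \<in> C - {0}" and uv: "0 \<le> u" "0 \<le> v" "u + v = 1"
  have C: "u *\<^sub>R x \<in> C" "v *\<^sub>R y \<in> C"
    using assms(1) xy uv by (auto intro: convex_cone_scaleR)
  have "u *\<^sub>R x + v *\<^sub>R y \<noteq> 0"
  proof
    assume "u *\<^sub>R x + v *\<^sub>R y = 0"
    then have "v *\<^sub>R y = - (u *\<^sub>R x)" by (simp add: eq_neg_iff_add_eq_0 add.commute)
    with C pointed have "u *\<^sub>R x = 0" "v *\<^sub>R y = 0" by (metis, metis neg_equal_0_iff_equal)
    with xy uv show False by auto
  qed
  with C assms(1) show "u *\<^sub>R x + v *\<^sub>R y \<in> C - {0}" by (simp add: convex_cone_add)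
qed


section \<open>Chebyshev polynomials\<close>

text \<open>\<open>cheb c (n + 1)\<close> is the value at \<open>c\<close> of the Chebyshev polynomial \<open>U\<^sub>n\<close> of the second kind.
  The index is shifted so that the recursion starts from \<open>0\<close>.\<close>

fun cheb :: "real \<Rightarrow> nat \<Rightarrow> real" where
  "cheb c 0 = 0"
| "cheb c (Suc 0) = 1"
| "cheb c (Suc (Suc n)) = 2 * c * cheb c (Suc n) - cheb c n"

lemma cheb_nonneg_ge_1:
  assumes "1 \<le> c"
  shows "0 \<le> cheb c n"
proof -
  \<comment> \<open>The recursion alone does not preserve the sign; it does preserve monotonicity.\<close>
  have "0 \<le> cheb c n \<and> cheb c n \<le> cheb c (Suc n)"
  proof (induction n)
    case (Suc n)
    then have "2 * cheb c (Suc n) \<le> 2 * c * cheb c (Suc n)"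
      using assms mult_right_mono[of 1 c "cheb c (Suc n)"] by simp
    with Suc show ?case by simp
  qed simp
  then show ?thesis by simp
qed

lemma sin_mult_cheb: "sin x * cheb (cos x) n = sin (real n * x)"
proof -
  have rec: "sin (real (Suc (Suc n)) * x) = 2 * cos x * sin (real (Suc n) * x) - sin (real n * x)" for n
  proof -
    have *: "sin (a + x) = 2 * cos x * sin a - sin (a - x)" for a
      by (simp add: sin_add sin_diff)
    show ?thesis using *[of "real (Suc n) * x"] by (simp add: algebra_simps)
  qed
  have "sin x * cheb (cos x) n = sin (real n * x)
      \<and> sin x * cheb (cos x) (Suc n) = sin (real (Suc n) * x)"
  proof (induction n)
    case (Suc n)
    have "sin x * cheb (cos x) (Suc (Suc n))
        = 2 * cos x * (sin x * cheb (cos x) (Suc n)) - sin x * cheb (cos x) n"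
      by (simp add: algebra_simps)
    then show ?case using Suc rec[of n] by simp
  qed simp
  then show ?thesis by simp
qed

lemma cheb_nonneg_cos:
  assumes "2 \<le> m" "n \<le> m"
  shows "0 \<le> cheb (cos (pi / real m)) n"
proof -
  have "0 < sin (pi / real m)"
    by (rule sin_gt_zero) (use assms in \<open>auto simp: field_simps\<close>)
  moreover have "0 \<le> sin (real n * (pi / real m))"
    by (rule sin_ge_zero) (use assms in \<open>auto simp: field_simps\<close>)
  ultimately show ?thesis
    by (metis sin_mult_cheb zero_le_mult_iff less_le_not_le)
qed


section \<open>Alternating products\<close>

text \<open>\<open>alternating s t k\<close> is the composition of \<open>k\<close> alternating factors \<open>s\<close> and \<open>t\<close>, of which \<open>t\<close>
  is the last in writing, that is, the first to be applied.\<close>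

fun alternating :: "('a \<Rightarrow> 'a) \<Rightarrow> ('a \<Rightarrow> 'a) \<Rightarrow> nat \<Rightarrow> 'a \<Rightarrow> 'a" where
  "alternating s t 0 = id"
| "alternating s t (Suc k) = alternating t s k \<circ> t"

lemma alternating_Suc_left:
  "alternating s t (Suc k) = (if even k then t else s) \<circ> alternating s t k"
proof (induction k arbitrary: s t)
  case (Suc k)
  have "alternating s t (Suc (Suc k)) = alternating t s (Suc k) \<circ> t" by simp
  also have "\<dots> = (if even k then s else t) \<circ> alternating t s k \<circ> t" by (simp only: Suc)
  finally show ?case by (simp add: comp_assoc)
qed simp

lemma comp_funpow_involution:
  assumes "s \<circ> s = id"
  shows "s \<circ> (s \<circ> t) ^^ n = (t \<circ> s) ^^ n \<circ> s"
proof (induction n)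
  case (Suc n)
  have "s \<circ> (s \<circ> t) ^^ Suc n = (s \<circ> (s \<circ> t) ^^ n) \<circ> (s \<circ> t)"
    by (simp only: funpow_Suc_right comp_assoc)
  also have "\<dots> = (t \<circ> s) ^^ n \<circ> (s \<circ> s) \<circ> t" by (simp only: Suc comp_assoc)
  also have "\<dots> = (t \<circ> s) ^^ n \<circ> t \<circ> (s \<circ> s)" by (simp only: assms comp_id)
  finally show ?case by (simp only: funpow_Suc_right comp_assoc)
qed simp

text \<open>For involutions \<open>s\<close> and \<open>t\<close>, the two alternating products with \<open>m\<close> factors are
  bijections that differ by the factor \<open>(s t)\<^sup>m\<close>, so they agree exactly when it is trivial.\<close>

lemma alternating_swap:
  assumes "s \<circ> s = id" "t \<circ> t = id"
  shows "alternating s t m = alternating t s m \<circ> (s \<circ> t) ^^ m"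
  using assms
proof (induction m arbitrary: s t)
  case (Suc m)
  have "alternating t s (Suc m) \<circ> (s \<circ> t) ^^ Suc m
      = alternating s t m \<circ> (s \<circ> (s \<circ> t) ^^ Suc m)"
    by (simp add: comp_assoc)
  also have "\<dots> = alternating s t m \<circ> (t \<circ> s) ^^ Suc m \<circ> s"
    by (simp only: comp_funpow_involution[OF Suc.prems(1)] comp_assoc)
  also have "\<dots> = (alternating s t m \<circ> (t \<circ> s) ^^ m) \<circ> t \<circ> (s \<circ> s)"
    by (simp only: funpow_Suc_right comp_assoc)
  also have "\<dots> = alternating t s m \<circ> t"
    by (simp only: Suc.IH[OF Suc.prems(2,1), symmetric] Suc.prems(1) comp_id)
  finally show ?case by (simp only: alternating.simps)
qed simp

lemma braid_relation:
  assumes "s \<circ> s = id" "t \<circ> t = id" "(s \<circ> t) ^^ m = id"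
  shows "alternating s t m = alternating t s m"
  using alternating_swap[OF assms(1,2), of m] assms(3) by simp

section \<open>Lengths and words\<close>

context geometric_representation
begin

abbreviation G where "G \<equiv> orthogonal_subgroup B W"
abbreviation len where "len \<equiv> word_length G S"
abbreviation Cone where "Cone \<equiv> nonneg_cone (\<alpha> ` S)"
abbreviation Roots where "Roots \<equiv> root_system W (\<alpha> ` S)"
abbreviation Pos where "Pos \<equiv> pos_roots W (\<alpha> ` S)"
abbreviation Inv where "Inv \<equiv> inversions W (\<alpha> ` S)"

lemma mult_G: "x \<otimes>\<^bsub>orthogonal_group B\<^esub> y = x \<circ> y"
  and one_G: "\<one>\<^bsub>orthogonal_group B\<^esub> = id"
  by (simp_all add: orthogonal_group_def)

lemma group_G: "group G" and S_subset: "S \<subseteq> W" and generate_S: "generate G S = W"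
  using coxeter unfolding coxeter_system_def by auto

lemma id_in_W: "id \<in> W"
  using group.is_monoid[OF group_G, THEN monoid.one_closed] by (simp add: one_G)

lemma comp_in_W: "u \<in> W \<Longrightarrow> v \<in> W \<Longrightarrow> u \<circ> v \<in> W"
  using group.is_monoid[OF group_G, THEN monoid.m_closed] by (simp add: mult_G)

lemma inverse_in_W:
  assumes "w \<in> W"
  obtains w' where "w' \<in> W" "w' \<circ> w = id" "w \<circ> w' = id"
  using assms group.l_inv[OF group_G, of w] group.r_inv[OF group_G, of w]
    group.inv_closed[OF group_G, of w]
  by (auto simp: mult_G one_G)

lemma
  assumes "w \<in> W"
  shows linear_W: "linear w" and B_W: "B (w u) (w v) = B u v"
  using subgroup.subset[OF W_subgroup] assms by (auto simp: orthogonal_group_def)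

lemma linear_B: "linear (B u)"
  using bilinear_B by (simp add: bilinear_def)

lemmas B_simps = linear_add[OF linear_B] linear_diff[OF linear_B] linear_neg[OF linear_B]
  linear_scale[OF linear_B] linear_sum[OF linear_B]

lemma W_simps:
  assumes "w \<in> W"
  shows "w (u + v) = w u + w v" "w (u - v) = w u - w v" "w (- u) = - w u"
    "w (r *\<^sub>R u) = r *\<^sub>R w u" "w 0 = 0"
  using linear_W[OF assms] by (simp_all add: linear_add linear_diff linear_neg linear_scale linear_0)

lemma finite_simple: "finite (\<alpha> ` S)"
  and simple_indep: "pos_lin_indep (\<alpha> ` S)"
  and B_simple: "s \<in> S \<Longrightarrow> B (\<alpha> s) (\<alpha> s) = 1"
  using simple by (auto simp: simple_system_def)

lemma reflection: "s \<in> S \<Longrightarrow> s v = v - (2 * B (\<alpha> s) v) *\<^sub>R \<alpha> s"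
  by (subst S_reflections) (simp_all add: bilin_reflection_def B_simple)

lemma reflection_simple: "s \<in> S \<Longrightarrow> s (\<alpha> s) = - \<alpha> s"
  by (simp add: reflection[of s] B_simple scaleR_2)

lemma involution: "s \<in> S \<Longrightarrow> s \<circ> s = id"
proof
  fix v assume s: "s \<in> S"
  have "B (\<alpha> s) (s v) = - B (\<alpha> s) v"
    by (simp add: reflection[OF s, of v] B_simps B_simple[OF s])
  then have "s (s v) = s v + (2 * B (\<alpha> s) v) *\<^sub>R \<alpha> s" using reflection[OF s, of "s v"] by simp
  then show "(s \<circ> s) v = id v" using reflection[OF s, of v] by simp
qed

lemma involution_apply: "s \<in> S \<Longrightarrow> s (s v) = v"
  by (drule involution) (simp add: fun_eq_iff)

lemma word_prod_simps [simp]: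
  "word_prod G [] = id" "word_prod G (s # xs) = s \<circ> word_prod G xs"
  by (simp_all add: word_prod_def orthogonal_group_def)

lemma word_prod_append: "word_prod G (xs @ ys) = word_prod G xs \<circ> word_prod G ys"
  by (induction xs) (simp_all add: comp_assoc)

lemma word_prod_in_W: "set xs \<subseteq> S \<Longrightarrow> word_prod G xs \<in> W"
  using S_subset by (induction xs) (auto intro: id_in_W comp_in_W)

lemma ex_word:
  assumes "w \<in> W"
  shows "\<exists>xs. set xs \<subseteq> S \<and> word_prod G xs = w"
proof -
  have "w \<in> generate G S" using assms by (simp only: generate_S)
  then show ?thesis
  proof (induction w rule: generate.induct)
    case one
    then show ?case by (intro exI[of _ "[]"]) (simp add: one_G)
  next
    case (incl s)
    then show ?case by (intro exI[of _ "[s]"]) simp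
  next
    case (inv s)
    have "inv\<^bsub>G\<^esub> s = s"
      by (rule group.inv_equality[OF group_G])
        (use inv S_subset involution in \<open>auto simp: mult_G one_G\<close>)
    with inv show ?case by (intro exI[of _ "[s]"]) simp
  next
    case (eng u v)
    then obtain xs ys where "set xs \<subseteq> S" "word_prod G xs = u" "set ys \<subseteq> S" "word_prod G ys = v"
      by blast
    then show ?case by (intro exI[of _ "xs @ ys"]) (simp add: word_prod_append mult_G)
  qed
qed

lemma len_word_prod_le: "set xs \<subseteq> S \<Longrightarrow> len (word_prod G xs) \<le> length xs"
  unfolding word_length_def by (rule Least_le) blast

lemma reduced_word:
  assumes "w \<in> W"
  obtains xs where "set xs \<subseteq> S" "length xs = len w" "word_prod G xs = w"
proof -
  have "\<exists>n xs. set xs \<subseteq> S \<and> length xs = n \<and> word_prod G xs = w" using ex_word[OF assms] by blast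
  then have "\<exists>xs. set xs \<subseteq> S \<and> length xs = len w \<and> word_prod G xs = w"
    unfolding word_length_def by (rule LeastI_ex)
  then show thesis using that by blast
qed

lemma len_comp_simple_le:
  assumes "w \<in> W" "s \<in> S"
  shows "len (w \<circ> s) \<le> len w + 1"
proof -
  obtain xs where xs: "set xs \<subseteq> S" "length xs = len w" "word_prod G xs = w"
    using reduced_word[OF assms(1)] .
  have "len (word_prod G (xs @ [s])) \<le> length (xs @ [s])"
    using xs assms by (intro len_word_prod_le) simp
  then show ?thesis using xs by (simp add: word_prod_append)
qed

lemma len_le_comp_simple:
  assumes "w \<in> W" "s \<in> S"
  shows "len w \<le> len (w \<circ> s) + 1"
proof -
  have "w \<circ> s \<circ> s = w" using involution[OF assms(2)] by (simp add: comp_assoc)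
  then show ?thesis
    using len_comp_simple_le[of "w \<circ> s" s] assms S_subset comp_in_W by (metis subsetD)
qed

lemma len_0: "w \<in> W \<Longrightarrow> len w = 0 \<Longrightarrow> w = id"
  by (metis reduced_word length_0_conv word_prod_simps(1))

lemma shortening_letter:
  assumes "w \<in> W" "0 < len w"
  obtains t where "t \<in> S" "len (w \<circ> t) + 1 = len w"
proof -
  obtain xs where xs: "set xs \<subseteq> S" "length xs = len w" "word_prod G xs = w"
    using reduced_word[OF assms(1)] .
  then obtain ys t where ys: "xs = ys @ [t]"
    using assms(2) by (cases xs rule: rev_cases) auto
  with xs have t: "t \<in> S" by simp
  have "w \<circ> t = word_prod G ys \<circ> (t \<circ> t)" using xs ys by (auto simp: word_prod_append comp_assoc)
  then have "w \<circ> t = word_prod G ys" by (simp add: involution[OF t])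
  then have "len (w \<circ> t) \<le> length ys" using len_word_prod_le[of ys] xs ys by simp
  then have "len (w \<circ> t) + 1 = len w"
    using xs ys len_le_comp_simple[OF assms(1) t] by simp
  with t show thesis by (rule that)
qed

lemma len_comp_alternating_le:
  assumes "v \<in> W" "s \<in> S" "t \<in> S"
  shows "len (v \<circ> alternating s t k) \<le> len v + k"
  using assms
proof (induction k arbitrary: v)
  case (Suc k)
  let ?p = "if even k then t else s"
  have p: "?p \<in> S" "v \<circ> ?p \<in> W" using Suc.prems S_subset comp_in_W by auto
  have "len (v \<circ> ?p \<circ> alternating s t k) \<le> len (v \<circ> ?p) + k"
    using Suc p by blast
  also have "\<dots> \<le> len v + Suc k" using len_comp_simple_le[OF Suc.prems(1) p(1)] by simp
  finally show ?case by (simp only: alternating_Suc_left comp_assoc)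
qed simp

text \<open>An alternating product with at least \<open>m\<close> factors, where \<open>m\<close> is the length of a braid
  relation, can be rewritten to end in the other letter. Multiplying by that letter then cancels
  a factor instead of adding one.\<close>

lemma len_comp_alternating_comp_le:
  assumes "v \<in> W" "s \<in> S" "t \<in> S" "(s \<circ> t) ^^ m = id" "0 < m" "m \<le> k"
  shows "len (v \<circ> alternating s t k \<circ> s) \<le> len v + (k - 1)"
  using \<open>m \<le> k\<close> \<open>v \<in> W\<close>
proof (induction k arbitrary: v rule: dec_induct)
  case base
  obtain n where n: "m = Suc n" using \<open>0 < m\<close> by (cases m) auto
  have "alternating s t m \<circ> s = alternating t s m \<circ> s"
    by (simp only: braid_relation[OF assms(2,3)[THEN involution] assms(4)])
  also have "\<dots> = alternating s t n \<circ> (s \<circ> s)" by (simp add: n comp_assoc)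
  finally have "v \<circ> alternating s t m \<circ> s = v \<circ> alternating s t n"
    using involution[OF assms(2)] by (simp add: comp_assoc)
  then have "len (v \<circ> alternating s t m \<circ> s) \<le> len v + n"
    using len_comp_alternating_le[OF base assms(2,3), of n] by (simp only:)
  moreover have "m - 1 = n" using n by simp
  ultimately show ?case by (simp only:)
next
  case (step k)
  let ?p = "if even k then t else s"
  have p: "?p \<in> S" "v \<circ> ?p \<in> W" using assms step.prems S_subset comp_in_W by auto
  have "len (v \<circ> ?p \<circ> alternating s t k \<circ> s) \<le> len (v \<circ> ?p) + (k - 1)"
    using step.IH[OF p(2)] .
  also have "\<dots> \<le> len v + (Suc k - 1)"
    using len_comp_simple_le[OF step.prems p(1)] step.hyps \<open>0 < m\<close> by simp
  finally show ?case by (simp only: alternating_Suc_left comp_assoc)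
qed


section \<open>Every root is positive or negative\<close>

lemma convex_cone_Cone: "convex_cone Cone"
  by (rule convex_cone_nonneg_cone[OF finite_simple])

lemma Cone_pointed: "x \<in> Cone \<Longrightarrow> - x \<in> Cone \<Longrightarrow> x = 0"
  by (rule nonneg_cone_pointed[OF finite_simple simple_indep])

lemma simple_in_Cone: "s \<in> S \<Longrightarrow> \<alpha> s \<in> Cone"
  by (intro nonneg_cone_superset imageI)

text \<open>Adding a factor on the left negates the root with coefficient \<open>cheb c k\<close> and adds \<open>2 c\<close> times
  it to the other one: this is one step of the Chebyshev recursion, with the roles of \<open>s\<close> and \<open>t\<close>
  exchanged.\<close>

lemma alternating_simple:
  assumes "s \<in> S" "t \<in> S" "B (\<alpha> s) (\<alpha> t) = - c"
  shows "alternating s t k (\<alpha> s)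
    = cheb c (Suc k) *\<^sub>R \<alpha> (if even k then s else t) + cheb c k *\<^sub>R \<alpha> (if even k then t else s)"
proof (induction k)
  case (Suc k)
  let ?p = "if even k then t else s" and ?q = "if even k then s else t"
  have p: "?p \<in> S" "?p \<in> W" using assms S_subset by auto
  have pq: "B (\<alpha> ?p) (\<alpha> ?q) = - c" using assms(3) symmetric_B[of "\<alpha> s" "\<alpha> t"] by simp
  have pp: "?p (\<alpha> ?p) = - \<alpha> ?p" using p(1) by (rule reflection_simple)
  have pq': "?p (\<alpha> ?q) = \<alpha> ?q + (2 * c) *\<^sub>R \<alpha> ?p"
    using reflection[OF p(1), of "\<alpha> ?q"] pq by simp
  have "alternating s t (Suc k) (\<alpha> s) = ?p (alternating s t k (\<alpha> s))"
    by (simp only: alternating_Suc_left comp_apply)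
  also have "\<dots> = cheb c (Suc k) *\<^sub>R ?p (\<alpha> ?q) + cheb c k *\<^sub>R ?p (\<alpha> ?p)"
    by (simp only: Suc W_simps[OF p(2)])
  also have "\<dots> = cheb c (Suc (Suc k)) *\<^sub>R \<alpha> ?p + cheb c (Suc k) *\<^sub>R \<alpha> ?q"
    unfolding pp pq' by (simp only: cheb.simps) (simp add: algebra_simps)
  finally show ?case by (simp only: even_Suc if_not_P if_cancel) (auto split: if_splits)
qed simp

lemma funpow_ord:
  assumes "x \<in> W"
  shows "x ^^ group.ord G x = id"
proof -
  have "x [^]\<^bsub>G\<^esub> n = x ^^ n" for n :: nat
    by (induction n) (simp_all add: nat_pow_def one_G mult_G funpow_Suc_right del: funpow.simps(2))
  then show ?thesis
    using group.pow_ord_eq_1[OF group_G, of x] assms by (simp add: one_G)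
qed

text \<open>Write \<open>w\<close> as \<open>v\<close> times an alternating product of \<open>s\<close> and \<open>t\<close> ending in \<open>t\<close>, with lengths
  adding up and as many factors as possible. Then neither \<open>s\<close> nor \<open>t\<close> shortens \<open>v\<close>, so by induction
  \<open>v\<close> sends both simple roots into the cone. It remains to see that the alternating product sends
  the simple root of \<open>s\<close> to a nonnegative combination of the two. This can fail only if it has at
  least \<open>m\<close> factors, where \<open>m\<close> is the finite order of \<open>s t\<close>; but then it could be rewritten to end
  in \<open>s\<close>, and \<open>s\<close> would shorten \<open>w\<close>.\<close>

theorem root_in_cone:
  assumes "w \<in> W" "s \<in> S" "len w \<le> len (w \<circ> s)"
  shows "w (\<alpha> s) \<in> Cone"
  using assms
proof (induction "len w" arbitrary: w s rule: less_induct)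
  case less
  show ?case
  proof (cases "len w = 0")
    case True
    then show ?thesis using len_0 less.prems simple_in_Cone by fastforce
  next
    case False
    then obtain t where t: "t \<in> S" "len (w \<circ> t) + 1 = len w"
      using shortening_letter[OF less.prems(1)] by blast
    then have st: "s \<noteq> t" using less.prems(3) by auto
    have stW: "s \<in> W" "t \<in> W" using S_subset less.prems t by auto
    let ?P = "\<lambda>k. \<exists>v\<in>W. w = v \<circ> alternating s t k \<and> len v + k = len w"
    have "?P 1"
      using t comp_in_W[OF less.prems(1) stW(2)] involution[OF t(1)]
      by (intro bexI[of _ "w \<circ> t"]) (simp_all add: comp_assoc)
    then obtain k where k: "?P k" and k_max: "\<And>j. ?P j \<Longrightarrow> j \<le> k"
      using Nat.ex_has_greatest_nat[of ?P 1 "len w"] by force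
    from k obtain v where v: "v \<in> W" "w = v \<circ> alternating s t k" "len v + k = len w" by blast
    have "1 \<le> k" using k_max[OF \<open>?P 1\<close>] .
    then obtain j where j: "k = Suc j" by (cases k) auto
    let ?p = "if even j then t else s" and ?q = "if even k then t else s"
    \<comment> \<open>The first factor of the alternating product is \<open>?p\<close>, and \<open>?q\<close> would extend it.\<close>
    have pq: "?p \<in> S" "?q \<in> S" using t less.prems by auto
    have p_le: "len v \<le> len (v \<circ> ?p)"
    proof -
      have "w = v \<circ> ?p \<circ> alternating s t j"
        unfolding v(2) j alternating_Suc_left by (simp only: comp_assoc)
      then have "len w \<le> len (v \<circ> ?p) + j"
        using len_comp_alternating_le[OF comp_in_W[OF v(1) subsetD[OF S_subset pq(1)]] less.prems(2) t(1)]
        by (simp only:)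
      then show ?thesis using v(3) j by simp
    qed
    have q_le: "len v \<le> len (v \<circ> ?q)"
    proof (rule ccontr)
      assume "\<not> ?thesis"
      then have "len (v \<circ> ?q) + Suc k = len w"
        using len_le_comp_simple[OF v(1) pq(2)] v(3) by linarith
      moreover have "w = v \<circ> ?q \<circ> alternating s t (Suc k)"
      proof -
        have "v \<circ> ?q \<circ> alternating s t (Suc k) = v \<circ> (?q \<circ> ?q) \<circ> alternating s t k"
          by (simp only: alternating_Suc_left comp_assoc)
        then show ?thesis unfolding involution[OF pq(2)] using v(2) by simp
      qed
      moreover have "v \<circ> ?q \<in> W" using comp_in_W[OF v(1)] pq S_subset by blast
      ultimately have "?P (Suc k)" by (intro bexI[of _ "v \<circ> ?q"] conjI)
      then have "Suc k \<le> k" by (rule k_max)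
      then show False by simp
    qed
    have "len v < len w" using v(3) \<open>1 \<le> k\<close> by simp
    then have "v (\<alpha> ?p) \<in> Cone" "v (\<alpha> ?q) \<in> Cone"
      using less.hyps[OF _ v(1) pq(1) p_le] less.hyps[OF _ v(1) pq(2) q_le] by (simp_all only:)
    then have vC: "v (\<alpha> s) \<in> Cone" "v (\<alpha> t) \<in> Cone" using j by (auto split: if_splits)
    define c where "c = - B (\<alpha> s) (\<alpha> t)"
    have nonneg: "0 \<le> cheb c k" "0 \<le> cheb c (Suc k)"
    proof -
      define m where "m = group.ord G (s \<circ> t)"
      have "0 \<le> cheb c k \<and> 0 \<le> cheb c (Suc k)"
      proof (cases "m = 0")
        case True
        then have "1 \<le> c"
          using B_infinite_order[OF less.prems(2) t(1) st] by (simp add: c_def m_def)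
        then show ?thesis using cheb_nonneg_ge_1 by blast
      next
        case False
        have pow: "(s \<circ> t) ^^ m = id" unfolding m_def by (rule funpow_ord[OF comp_in_W[OF stW]])
        have "m \<noteq> 1"
        proof
          assume "m = 1"
          then have "s \<circ> t = id" using pow by simp
          then have "s \<circ> (t \<circ> t) = t" by (simp flip: comp_assoc)
          then show False using st involution[OF t(1)] by simp
        qed
        with False have m2: "2 \<le> m" by simp
        have "k < m"
        proof (rule ccontr)
          assume "\<not> k < m"
          then have "len (w \<circ> s) \<le> len v + (k - 1)"
            using len_comp_alternating_comp_le[OF v(1) less.prems(2) t(1) pow] m2 v(2) by simp
          then show False using less.prems(3) v(3) \<open>1 \<le> k\<close> by linarith
        qed
        moreover have "c = cos (pi / real m)"
          using B_finite_order[OF less.prems(2) t(1) st m_def False] by (simp add: c_def)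
        ultimately show ?thesis using cheb_nonneg_cos[OF m2] by simp
      qed
      then show "0 \<le> cheb c k" "0 \<le> cheb c (Suc k)" by simp_all
    qed
    have "B (\<alpha> s) (\<alpha> t) = - c" by (simp add: c_def)
    note alternating_simple[OF less.prems(2) t(1) this, of k]
    then have "w (\<alpha> s) = cheb c (Suc k) *\<^sub>R v (\<alpha> (if even k then s else t))
        + cheb c k *\<^sub>R v (\<alpha> (if even k then t else s))"
      using v(2) W_simps[OF v(1)] by simp
    moreover have "v (\<alpha> (if even k then s else t)) \<in> Cone" "v (\<alpha> (if even k then t else s)) \<in> Cone"
      using vC by simp_all
    ultimately show ?thesis
      using nonneg convex_cone_Cone by (simp add: convex_cone_add convex_cone_scaleR)
  qed
qed

lemma root_systemE:
  assumes "\<beta> \<in> Roots"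
  obtains w s where "w \<in> W" "s \<in> S" "\<beta> = w (\<alpha> s)"
  using assms unfolding root_system_def by auto

lemma root_systemI: "w \<in> W \<Longrightarrow> s \<in> S \<Longrightarrow> w (\<alpha> s) \<in> Roots"
  unfolding root_system_def by auto

lemma W_Roots: "w \<in> W \<Longrightarrow> \<beta> \<in> Roots \<Longrightarrow> w \<beta> \<in> Roots"
  by (metis root_systemE root_systemI comp_in_W comp_apply)

lemma minus_Roots: "\<beta> \<in> Roots \<Longrightarrow> - \<beta> \<in> Roots"
proof (elim root_systemE)
  fix w s assume ws: "w \<in> W" "s \<in> S" "\<beta> = w (\<alpha> s)"
  then have "w \<circ> s \<in> W" using S_subset comp_in_W by blast
  then have "(w \<circ> s) (\<alpha> s) \<in> Roots" using ws(2) by (rule root_systemI)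
  also have "(w \<circ> s) (\<alpha> s) = - \<beta>" using ws by (simp add: reflection_simple W_simps)
  finally show ?thesis .
qed

lemma B_root: "\<beta> \<in> Roots \<Longrightarrow> B \<beta> \<beta> = 1"
  by (elim root_systemE) (simp add: B_W B_simple)

lemma root_nonzero: "\<beta> \<in> Roots \<Longrightarrow> \<beta> \<noteq> 0"
  using B_root linear_0[OF linear_B] by force

text \<open>Either \<open>w\<close> or \<open>w s\<close> is not shortened by \<open>s\<close>, and these two send the simple root of \<open>s\<close> to
  opposite roots.\<close>

lemma root_pos_or_neg:
  assumes "\<beta> \<in> Roots"
  shows "\<beta> \<in> Pos \<or> - \<beta> \<in> Pos"
proof -
  obtain w s where ws: "w \<in> W" "s \<in> S" "\<beta> = w (\<alpha> s)" using assms by (rule root_systemE)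
  have w's: "w \<circ> s \<in> W" using ws S_subset comp_in_W by blast
  have *: "w \<circ> s \<circ> s = w" using involution[OF ws(2)] by (simp add: comp_assoc)
  have **: "(w \<circ> s) (\<alpha> s) = - \<beta>" using ws by (simp add: reflection_simple W_simps)
  have "\<beta> \<in> Cone \<or> - \<beta> \<in> Cone"
  proof (cases "len w \<le> len (w \<circ> s)")
    case True
    then show ?thesis using root_in_cone[OF ws(1,2)] ws(3) by simp
  next
    case False
    then have "len (w \<circ> s) \<le> len (w \<circ> s \<circ> s)" unfolding * by simp
    then show ?thesis using root_in_cone[OF w's ws(2)] unfolding ** by simp
  qed
  then show ?thesis using assms minus_Roots[OF assms] by (auto simp: pos_roots_def)
qed

lemma not_pos_and_neg: "\<beta> \<in> Pos \<Longrightarrow> - \<beta> \<in> Cone \<Longrightarrow> False"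
  using Cone_pointed[of \<beta>] root_nonzero[of \<beta>] by (simp add: pos_roots_def)


section \<open>Inversion sets\<close>

lemma B_simple_nonpos:
  assumes "a \<in> \<alpha> ` S" "b \<in> \<alpha> ` S" "a \<noteq> b"
  shows "B a b \<le> 0"
proof -
  have "0 \<le> cos (pi / real k)" if "2 \<le> k" for k :: nat
    by (rule cos_ge_zero) (use that pi_gt_zero in \<open>auto simp: field_simps intro: order_trans[of _ 0]\<close>)
  then show ?thesis
    using simple assms unfolding simple_system_def by fastforce
qed

text \<open>Subtracting from a positive root \<open>\<beta>\<close> a multiple of a simple root changes just one
  coefficient, so if the result is negative then \<open>\<beta>\<close> should be a multiple of that simple root. As
  the simple roots need not be linearly independent, coefficients are not unique, and the argument
  is completed by the sign of \<open>B\<close> on pairs of distinct simple roots: it prevents a simple root from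
  being a nonnegative combination of the others.\<close>

lemma simple_reflection_pos:
  assumes "\<beta> \<in> Pos" "s \<in> S" "\<beta> \<noteq> \<alpha> s"
  shows "s \<beta> \<in> Pos"
proof (rule ccontr)
  let ?D = "\<alpha> ` S" and ?a = "\<alpha> s"
  assume "s \<beta> \<notin> Pos"
  have root: "\<beta> \<in> Roots" "\<beta> \<in> Cone" using assms(1) by (auto simp: pos_roots_def)
  have "s \<beta> \<in> Roots" using W_Roots[OF _ root(1)] assms(2) S_subset by blast
  with \<open>s \<beta> \<notin> Pos\<close> have neg: "- s \<beta> \<in> Cone" using root_pos_or_neg by (auto simp: pos_roots_def)
  obtain c where c: "\<forall>a\<in>?D. 0 \<le> c a" "\<beta> = (\<Sum>a\<in>?D. c a *\<^sub>R a)"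
    using root(2) unfolding nonneg_cone_finite[OF finite_simple] by auto
  obtain d where d: "\<forall>a\<in>?D. 0 \<le> d a" "- s \<beta> = (\<Sum>a\<in>?D. d a *\<^sub>R a)"
    using neg unfolding nonneg_cone_finite[OF finite_simple] by auto
  define \<mu> where "\<mu> = 2 * B ?a \<beta>"
  define e where "e a = c a + d a" for a
  have e_nonneg: "0 \<le> e a" if "a \<in> ?D" for a 
    using bspec[OF c(1) that] bspec[OF d(1) that] by (simp add: e_def)
  have aD: "?a \<in> ?D" using assms(2) by (rule imageI)
  have "(\<Sum>a\<in>?D. e a *\<^sub>R a) = \<beta> + - s \<beta>"
    unfolding d(2) by (simp add: e_def scaleR_left_distrib sum.distrib c(2)[symmetric])
  also have "\<dots> = \<mu> *\<^sub>R ?a" using reflection[OF assms(2), of \<beta>] by (simp add: \<mu>_def)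
  finally have sum_e: "(\<Sum>a\<in>?D. e a *\<^sub>R a) = \<mu> *\<^sub>R ?a" .
  have split: "(\<Sum>a\<in>?D. f a *\<^sub>R a) = f ?a *\<^sub>R ?a + (\<Sum>a\<in>?D - {?a}. f a *\<^sub>R a)" for f
    by (rule sum.remove[OF finite_simple aD])
  have rest: "(\<Sum>a\<in>?D - {?a}. e a *\<^sub>R a) = (\<mu> - e ?a) *\<^sub>R ?a"
    using sum_e unfolding split by (simp add: algebra_simps)
  have "\<mu> - e ?a = B ?a ((\<mu> - e ?a) *\<^sub>R ?a)" using B_simple[OF assms(2)] by (simp add: B_simps)
  also have "\<dots> = (\<Sum>a\<in>?D - {?a}. e a * B ?a a)" unfolding rest[symmetric] by (simp add: B_simps)
  \<comment> \<open>Otherwise \<open>rest\<close> would exhibit \<open>?a\<close> as a nonnegative combination of other simple roots.\<close>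
  also have "\<dots> \<le> 0"
    using aD by (intro sum_nonpos mult_nonneg_nonpos e_nonneg B_simple_nonpos) auto
  finally have \<mu>: "\<mu> \<le> e ?a" by simp
  define f where "f a = (if a = ?a then e a - \<mu> else e a)" for a
  have "(\<Sum>a\<in>?D - {?a}. f a *\<^sub>R a) = (\<Sum>a\<in>?D - {?a}. e a *\<^sub>R a)"
    by (rule sum.cong) (auto simp: f_def)
  then have "(\<Sum>a\<in>?D. f a *\<^sub>R a) = 0"
    unfolding split[of f] rest by (simp add: f_def algebra_simps)
  moreover have "\<forall>a\<in>?D. 0 \<le> f a" using e_nonneg \<mu> by (simp add: f_def)
  ultimately have f0: "\<forall>a\<in>?D. f a = 0"
    using spec[OF simple_indep[unfolded pos_lin_indep_def], of f] by (elim mp) (intro conjI)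
  have c0: "c a = 0" if "a \<in> ?D - {?a}" for a
  proof -
    have "f a = 0" using f0 that by (meson DiffD1)
    then have "c a + d a = 0" using that by (simp add: f_def e_def)
    moreover have "0 \<le> c a" "0 \<le> d a" using that c(1) d(1) by (meson DiffD1)+
    ultimately show ?thesis by linarith
  qed
  then have \<beta>: "\<beta> = c ?a *\<^sub>R ?a" unfolding c(2) split[of c] by simp
  have "1 = B \<beta> \<beta>" using B_root[OF root(1)] by simp
  also have "\<dots> = c ?a * B \<beta> ?a" by (subst (2) \<beta>) (simp add: B_simps)
  also have "B \<beta> ?a = c ?a * B ?a ?a" by (subst symmetric_B, subst \<beta>) (simp add: B_simps)
  finally have "c ?a * c ?a = 1" using B_simple[OF assms(2)] by simp
  moreover have "0 \<le> c ?a" using c(1) aD by (rule bspec)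
  ultimately have "c ?a = 1" by (metis abs_of_nonneg abs_square_eq_1 power2_eq_square)
  with \<beta> assms(3) show False by simp
qed

lemma Inv_iff: "\<beta> \<in> Inv w \<longleftrightarrow> \<beta> \<in> Pos \<and> (\<exists>\<gamma>\<in>Pos. \<beta> = w (- \<gamma>))"
  unfolding inversions_def neg_roots_def by auto

text \<open>By \<open>simple_reflection_pos\<close>, multiplying on the left by a simple reflection \<open>s\<close> moves the
  inversions by \<open>s\<close> and adds at most one new inversion, the simple root of \<open>s\<close>.\<close>

lemma finite_inversions:
  assumes "w \<in> W"
  shows "finite (Inv w)"
proof -
  have "finite (Inv (word_prod G xs))" if "set xs \<subseteq> S" for xs
    using that
  proof (induction xs)
    case Nil
    have "\<beta> \<notin> Inv id" for \<beta>
    proof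
      assume "\<beta> \<in> Inv id"
      then have "\<beta> \<in> Pos" "- \<beta> \<in> Cone" unfolding Inv_iff by (auto simp: pos_roots_def)
      then show False by (rule not_pos_and_neg)
    qed
    then have "Inv id = {}" by blast
    then show ?case by (simp only: word_prod_simps finite.emptyI)
  next
    case (Cons s xs)
    let ?w = "word_prod G xs"
    have s: "s \<in> S" using Cons.prems by simp
    have "Inv (s \<circ> ?w) \<subseteq> insert (\<alpha> s) (s ` Inv ?w)"
    proof
      fix \<beta> assume "\<beta> \<in> Inv (s \<circ> ?w)"
      then obtain \<gamma> where \<gamma>: "\<beta> \<in> Pos" "\<gamma> \<in> Pos" "\<beta> = s (?w (- \<gamma>))" unfolding Inv_iff by auto
      show "\<beta> \<in> insert (\<alpha> s) (s ` Inv ?w)"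
      proof (cases "\<beta> = \<alpha> s")
        case False
        with \<gamma>(1) s have "s \<beta> \<in> Pos" by (rule simple_reflection_pos)
        moreover have "s \<beta> = ?w (- \<gamma>)" unfolding \<gamma>(3) by (rule involution_apply[OF s])
        ultimately have "s \<beta> \<in> Inv ?w" unfolding Inv_iff using \<gamma>(2) by blast
        then have "s (s \<beta>) \<in> s ` Inv ?w" by (rule imageI)
        then show ?thesis by (simp add: involution_apply[OF s])
      qed simp
    qed
    moreover have "finite (insert (\<alpha> s) (s ` Inv ?w))" using Cons by simp
    ultimately show ?case unfolding word_prod_simps by (rule finite_subset)
  qed
  then show ?thesis using ex_word[OF assms] by blast
qed

text \<open>An inversion of \<open>w\<close> is the image of a negative root, and right multiplication by \<open>s\<close> keeps
  the sign of that root unless it is minus the simple root of \<open>s\<close>. The image of the latter is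
  negative by \<open>root_in_cone\<close>, so it is no inversion.\<close>

lemma inversions_mono:
  assumes "w \<in> W" "s \<in> S" "len w \<le> len (w \<circ> s)"
  shows "Inv w \<subseteq> Inv (w \<circ> s)"
proof
  fix \<beta> assume "\<beta> \<in> Inv w"
  then obtain \<gamma> where \<gamma>: "\<beta> \<in> Pos" "\<gamma> \<in> Pos" "\<beta> = w (- \<gamma>)" unfolding Inv_iff by auto
  have "\<gamma> \<noteq> \<alpha> s"
  proof
    assume "\<gamma> = \<alpha> s"
    then have "- \<beta> \<in> Cone" using root_in_cone[OF assms] \<gamma>(3) by (simp add: W_simps[OF assms(1)])
    with \<gamma>(1) show False by (rule not_pos_and_neg)
  qed
  with \<gamma>(2) assms(2) have "s \<gamma> \<in> Pos" by (rule simple_reflection_pos)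
  moreover have "\<beta> = (w \<circ> s) (- s \<gamma>)"
    using \<gamma>(3) assms(2) S_subset by (auto simp: W_simps involution_apply)
  ultimately show "\<beta> \<in> Inv (w \<circ> s)" unfolding Inv_iff using \<gamma>(1) by blast
qed

lemma word_prefix_Suc: "word_prefix G \<omega> (Suc i) = word_prefix G \<omega> i \<circ> \<omega> i"
  by (simp add: word_prefix_def word_prod_append)

lemma word_prefix_in_W: "\<omega> \<in> inf_reduced_words G S \<Longrightarrow> word_prefix G \<omega> i \<in> W"
  unfolding word_prefix_def inf_reduced_words_def by (intro word_prod_in_W) auto

lemma inversions_word_prefix_mono:
  assumes "\<omega> \<in> inf_reduced_words G S" "i \<le> j"
  shows "Inv (word_prefix G \<omega> i) \<subseteq> Inv (word_prefix G \<omega> j)"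
  using assms(2)
proof (induction j rule: dec_induct)
  case (step j)
  have "len (word_prefix G \<omega> n) = n" for n
  proof (cases n)
    case 0
    then show ?thesis using len_word_prod_le[of "[]"] by (simp add: word_prefix_def)
  qed (use assms(1) in \<open>auto simp: inf_reduced_words_def\<close>)
  then have "len (word_prefix G \<omega> j) \<le> len (word_prefix G \<omega> j \<circ> \<omega> j)"
    by (simp only: word_prefix_Suc[symmetric])
  moreover have "\<omega> j \<in> S" using assms(1) by (auto simp: inf_reduced_words_def)
  ultimately have "Inv (word_prefix G \<omega> j) \<subseteq> Inv (word_prefix G \<omega> (Suc j))"
    unfolding word_prefix_Suc using word_prefix_in_W[OF assms(1)] by (intro inversions_mono)
  with step.IH show ?case by (rule order_trans)
qed simp


section \<open>Separation of inversions from limit roots\<close>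

lemma normalized_pos_root:
  assumes "transverse H P" "\<beta> \<in> P"
  obtains r where "0 < r" "normalized_root H P \<beta> = r *\<^sub>R \<beta>"
proof -
  have "\<exists>!x. x \<in> ray \<beta> \<inter> H \<and> x \<noteq> 0" 
    using assms(1)[unfolded transverse_def] assms(2) by (rule bspec)
  then have "normalized_root H P \<beta> \<in> ray \<beta> \<inter> H \<and> normalized_root H P \<beta> \<noteq> 0"
    unfolding normalized_root_def using assms(2) by (simp only: if_True) (rule theI')
  then obtain r where "0 \<le> r" "normalized_root H P \<beta> = r *\<^sub>R \<beta>" "normalized_root H P \<beta> \<noteq> 0"
    unfolding ray_def by auto
  then show thesis by (intro that[of r]) (auto simp: order_less_le)
qed

lemma normalized_root_minus:
  assumes "\<beta> \<notin> P" "- \<beta> \<in> P"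
  shows "normalized_root H P \<beta> = normalized_root H P (- \<beta>)"
  using assms by (simp add: normalized_root_def)

lemma hull_inversions_disjoint_hull_limit_roots:
  assumes "transverse H Pos" "w \<in> W"
  shows "convex hull (normalized_root H Pos ` Inv w)
           \<inter> convex hull (limit_roots W (\<alpha> ` S) H) = {}"
proof -
  let ?n = "normalized_root H Pos"
  obtain w' where w': "w' \<in> W" "w' \<circ> w = id" "w \<circ> w' = id" using inverse_in_W[OF assms(2)] .
  have inv_apply: "w' (w v) = v" "w (w' v) = v" for v
    using w'(2,3) by (simp_all add: fun_eq_iff)
  define K where "K = w' -` Cone"
  have "closed K"
    unfolding K_def using linear_W[OF w'(1)] closed_nonneg_cone[OF finite_simple]
    by (intro closed_vimage linear_continuous_on) (simp_all add: linear_conv_bounded_linear)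
  have convex_Cone: "convex Cone" using convex_cone_Cone by (simp add: convex_cone_def)
  have "convex K"
    unfolding K_def using linear_W[OF w'(1)] convex_Cone by (rule convex_linear_vimage)
  \<comment> \<open>Up to the finite set of normalized inversions, all normalized roots lie in \<open>K\<close>.\<close>
  have "?n ` Roots \<subseteq> ?n ` Inv w \<union> K"
  proof (rule image_subsetI)
    have *: "?n \<beta> \<in> ?n ` Inv w \<union> K" if \<beta>: "\<beta> \<in> Pos" for \<beta>
    proof (cases "w' \<beta> \<in> Pos")
      case True
      obtain r where r: "0 < r" "?n \<beta> = r *\<^sub>R \<beta>" using normalized_pos_root[OF assms(1) \<beta>] .
      have "w' (?n \<beta>) = r *\<^sub>R w' \<beta>" unfolding r(2) by (simp add: W_simps[OF w'(1)])
      then show ?thesis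
        using True r(1) convex_cone_scaleR[OF convex_cone_Cone, of r "w' \<beta>"]
        by (simp add: K_def pos_roots_def)
    next
      case False
      moreover have "w' \<beta> \<in> Roots" using \<beta> W_Roots[OF w'(1)] by (simp add: pos_roots_def)
      ultimately have "- w' \<beta> \<in> Pos" using root_pos_or_neg by blast
      moreover have "\<beta> = w (- (- w' \<beta>))" by (simp add: inv_apply)
      ultimately have "\<beta> \<in> Inv w" unfolding Inv_iff using \<beta> by blast
      then show ?thesis by blast
    qed
    fix \<beta> assume \<beta>: "\<beta> \<in> Roots"
    show "?n \<beta> \<in> ?n ` Inv w \<union> K"
    proof (cases "\<beta> \<in> Pos")
      case False
      then have "- \<beta> \<in> Pos" using root_pos_or_neg[OF \<beta>] by simp
      with False show ?thesis using *[of "- \<beta>"] by (simp add: normalized_root_minus)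
    qed (rule *)
  qed
  then have "x islimpt K" if "x \<in> limit_roots W (\<alpha> ` S) H" for x
    using that islimpt_subset[of x "?n ` Roots" "?n ` Inv w \<union> K"] finite_inversions[OF assms(2)]
    by (simp add: limit_roots_def islimpt_Un_finite)
  then have "limit_roots W (\<alpha> ` S) H \<subseteq> K"
    using \<open>closed K\<close> closed_limpt by blast
  then have hull_E: "convex hull limit_roots W (\<alpha> ` S) H \<subseteq> K"
    using \<open>convex K\<close> by (rule hull_minimal)
  \<comment> \<open>The point \<open>0\<close> is removed while the set stays convex, because the cone is pointed.\<close>
  define N where "N = (Cone - {0}) \<inter> (\<lambda>v. - w' v) -` Cone"
  have "linear (\<lambda>v. - w' v)" using linear_W[OF w'(1)] by (rule linear_compose_neg)
  then have "convex N"
    unfolding N_def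
    by (intro convex_Int convex_linear_vimage convex_Cone
        convex_pointed_cone_minus_0[OF convex_cone_Cone] Cone_pointed)
  moreover have "?n ` Inv w \<subseteq> N"
  proof (rule image_subsetI)
    fix \<beta> assume "\<beta> \<in> Inv w"
    then obtain \<gamma> where \<gamma>: "\<beta> \<in> Pos" "\<gamma> \<in> Pos" "\<beta> = w (- \<gamma>)" unfolding Inv_iff by auto
    obtain r where r: "0 < r" "?n \<beta> = r *\<^sub>R \<beta>" using normalized_pos_root[OF assms(1) \<gamma>(1)] .
    have "w' \<beta> = - \<gamma>" unfolding \<gamma>(3) by (rule inv_apply)
    then have "- w' (?n \<beta>) = r *\<^sub>R \<gamma>" unfolding r(2) by (simp add: W_simps[OF w'(1)])
    moreover have "r *\<^sub>R \<gamma> \<in> Cone" "r *\<^sub>R \<beta> \<in> Cone"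
      using \<gamma>(1,2) r(1) convex_cone_scaleR[OF convex_cone_Cone] by (auto simp: pos_roots_def)
    moreover have "\<beta> \<noteq> 0" using \<gamma>(1) root_nonzero by (auto simp: pos_roots_def)
    ultimately show "?n \<beta> \<in> N" using r by (simp add: N_def)
  qed
  ultimately have hull_N: "convex hull (?n ` Inv w) \<subseteq> N" by (intro hull_minimal)
  have "N \<inter> K = {}"
  proof (rule equals0I)
    fix y assume "y \<in> N \<inter> K"
    then have y: "y \<noteq> 0" "- w' y \<in> Cone" "w' y \<in> Cone" by (auto simp: N_def K_def)
    then have "w' y = 0" using Cone_pointed by blast
    then have "y = 0" using inv_apply(2)[of y] W_simps(5)[OF assms(2)] by simp
    with y(1) show False ..
  qed
  with hull_E hull_N show ?thesis by blast
qed

end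

lemma convex_hull_increasing_UN:
  fixes A :: "nat \<Rightarrow> 'a::real_vector set"
  assumes "\<And>i j. i \<le> j \<Longrightarrow> A i \<subseteq> A j"
  shows "convex hull (\<Union>i. A i) \<subseteq> (\<Union>i. convex hull A i)"
proof (rule hull_minimal)
  show "(\<Union>i. A i) \<subseteq> (\<Union>i. convex hull A i)" by (auto intro: hull_inc)
  show "convex (\<Union>i. convex hull A i)"
  proof (rule convexI)
    fix x y and u v :: real
    assume "x \<in> (\<Union>i. convex hull A i)" "y \<in> (\<Union>i. convex hull A i)" and uv: "0 \<le> u" "0 \<le> v" "u + v = 1"
    then obtain i j where "x \<in> convex hull A i" "y \<in> convex hull A j" by blast
    then have "x \<in> convex hull A (max i j)" "y \<in> convex hull A (max i j)"
      using hull_mono[OF assms, of i "max i j"] hull_mono[OF assms, of j "max i j"] by auto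
    then have "u *\<^sub>R x + v *\<^sub>R y \<in> convex hull A (max i j)"
      using uv by (intro convexD[OF convex_convex_hull])
    then show "u *\<^sub>R x + v *\<^sub>R y \<in> (\<Union>i. convex hull A i)" by blast
  qed
qed

theorem corollary4p4:
  fixes B :: "'v::euclidean_space \<Rightarrow> 'v \<Rightarrow> real"
    and W S :: "('v \<Rightarrow> 'v) set"
    and \<alpha> :: "('v \<Rightarrow> 'v) \<Rightarrow> 'v"
    and V\<^sub>1 :: "'v set"
    and \<Omega> :: "(nat \<Rightarrow> 'v \<Rightarrow> 'v) set"
    and \<omega> :: "nat \<Rightarrow> 'v \<Rightarrow> 'v"
  assumes "geometric_representation B W S \<alpha>"
    and "affine_hyperplane V\<^sub>1"
    and "transverse V\<^sub>1 (pos_roots W (\<alpha> ` S))"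
    and "\<Omega> \<in> inf_word_classes (orthogonal_subgroup B W) S"
    and "\<omega> \<in> \<Omega>"
  shows "convex hull (normalized_root V\<^sub>1 (pos_roots W (\<alpha> ` S)) ` inf_inversions B W (\<alpha> ` S) \<omega>)
           \<inter> convex hull (limit_roots W (\<alpha> ` S) V\<^sub>1) = {}"
proof -
  interpret geometric_representation B W S \<alpha> by fact
  let ?A = "\<lambda>i. normalized_root V\<^sub>1 Pos ` Inv (word_prefix G \<omega> i)"
  have \<omega>: "\<omega> \<in> inf_reduced_words G S"
    using assms(4,5) unfolding inf_word_classes_def word_equiv_def quotient_def by auto
  have "normalized_root V\<^sub>1 Pos ` inf_inversions B W (\<alpha> ` S) \<omega> \<subseteq> (\<Union>i. ?A i)"
    unfolding inf_inversions_def by blast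
  then have "convex hull (normalized_root V\<^sub>1 Pos ` inf_inversions B W (\<alpha> ` S) \<omega>)
      \<subseteq> convex hull (\<Union>i. ?A i)"
    by (rule hull_mono)
  also have "\<dots> \<subseteq> (\<Union>i. convex hull ?A i)"
    by (intro convex_hull_increasing_UN image_mono inversions_word_prefix_mono[OF \<omega>])
  finally show ?thesis
    using hull_inversions_disjoint_hull_limit_roots[OF assms(3) word_prefix_in_W[OF \<omega>]] by blast
qed

end
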